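(* Let $m\in(0,1)\cup\mathbb{N}$, $0<\alpha<2m<n$, $\frac{n-\alpha}{n-2m}<p<\infty$, $q_c=\frac{n(p-1)}{2m-\alpha}$. Let $F:\mathbb{R}\to\mathbb{R}$ satisfy $F(0)=0$, $|F(a)-F(b)|\le C|a-b|(|a|^{p-1}+|b|^{p-1})$ for some constant $C>0$ and all $a,b\in\mathbb{R}$, and $F(\lambda a)=\lambda^pF(a)$ for all $\lambda>0$, $a\in\mathbb{R}$. There is no nontrivial self-similar solution in $C_b([0,\infty);L^{q_c}(\mathbb{R}^n))$ that is initially small in $L^{q_c}(\mathbb{R}^n)$ of the integral equation $$u(t)=e^{-t(-\Delta)^m}u_0+\int_0^t e^{-(t-\tau)(-\Delta)^m}|\cdot|^{-\alpha}F(u(\tau))\,d\tau,\qquad t>0.$$ That is, there exists $\varepsilon>0$ such that if $u\in C_b([0,\infty);L^{q_c}(\mathbb{R}^n))$ solves this equation with $\|u_0\|_{L^{q_c}}<\varepsilon$ and $u$ is self-similar, then $u=0$ a.e. on $\mathbb{R}^n\times(0,\infty)$.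
   Context: $e^{-t(-\Delta)^m}$ is convolution with the kernel $g_m(\cdot,t)$, $\widehat{g_m}(\xi,t)=e^{-t|\xi|^{2m}}$. $C_b([0,\infty);L^{q_c}(\mathbb{R}^n))$ is the space of bounded (norm-)continuous functions of $t\in[0,\infty)$ with values in $L^{q_c}(\mathbb{R}^n)$, with $u(0)=u_0$. A solution $u$ is self-similar if $u=u_\sigma$ for every $\sigma>0$, where $u_\sigma(x,t)=\sigma^{\frac{2m-\alpha}{p-1}}u(\sigma x,\sigma^{2m}t)$. *)

theory Defs
  imports "HOL-Analysis.Analysis"
begin

text \<open>
  Elements of a Lebesgue space are represented by real-valued Lebesgue measurable functions;
  equality of elements is equality almost everywhere.
\<close>

definition Lp_norm :: "real \<Rightarrow> ('a::euclidean_space \<Rightarrow> real) \<Rightarrow> real" where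
  "Lp_norm q f = (LINT x|lebesgue. \<bar>f x\<bar> powr q) powr (1 / q)"

definition Lp_space :: "real \<Rightarrow> ('a::euclidean_space \<Rightarrow> real) set" where
  "Lp_space q = {f \<in> borel_measurable lebesgue. integrable lebesgue (\<lambda>x. \<bar>f x\<bar> powr q)}"

definition Cb_Lp :: "real \<Rightarrow> (real \<Rightarrow> 'a::euclidean_space \<Rightarrow> real) set" where
  "Cb_Lp q = {u.
     (\<forall>t\<ge>0. u t \<in> Lp_space q) \<and>
     (\<exists>K. \<forall>t\<ge>0. Lp_norm q (u t) \<le> K) \<and>
     (\<forall>s\<ge>0. ((\<lambda>t. Lp_norm q (\<lambda>x. u t x - u s x)) \<longlongrightarrow> 0) (at s within {0..}))}"

text \<open>
  The kernel with Fourier transform \<open>exp (- t * norm \<xi> powr (2 * m))\<close>, given by Fourier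
  inversion. The convention is that the transform of \<open>f\<close> at \<open>\<xi>\<close> is the integral of
  \<open>f x * exp (- \<i> * (x \<bullet> \<xi>))\<close>, for which minus the Laplacian has symbol \<open>(norm \<xi>)\<^sup>2\<close>.
  The inversion integral is real because the transform is even.
\<close>

definition heat_kernel :: "real \<Rightarrow> real \<Rightarrow> 'a::euclidean_space \<Rightarrow> real" where
  "heat_kernel m t x =
     Re (LINT \<xi>|lebesgue. exp (\<i> * complex_of_real (x \<bullet> \<xi>)) *
                           complex_of_real (exp (- t * norm \<xi> powr (2 * m))))
       / (2 * pi) ^ DIM('a)"

definition heat_semigroup ::
    "real \<Rightarrow> real \<Rightarrow> ('a::euclidean_space \<Rightarrow> real) \<Rightarrow> 'a \<Rightarrow> real" where
  "heat_semigroup m t f x = (LINT y|lebesgue. heat_kernel m t (x - y) * f y)"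

definition duhamel_integrand ::
    "real \<Rightarrow> real \<Rightarrow> (real \<Rightarrow> real) \<Rightarrow> (real \<Rightarrow> 'a::euclidean_space \<Rightarrow> real) \<Rightarrow>
     real \<Rightarrow> 'a \<Rightarrow> real \<Rightarrow> real" where
  "duhamel_integrand m \<alpha> F u t x \<tau> =
     heat_semigroup m (t - \<tau>) (\<lambda>y. norm y powr (- \<alpha>) * F (u \<tau> y)) x"

text \<open>
  The time integral is taken pointwise for almost every \<open>x\<close>. Its absolute convergence is
  required so that the equation never refers to the default value of a divergent integral.
\<close>

definition solves_integral_equation ::
    "real \<Rightarrow> real \<Rightarrow> (real \<Rightarrow> real) \<Rightarrow> ('a::euclidean_space \<Rightarrow> real) \<Rightarrow>
     (real \<Rightarrow> 'a \<Rightarrow> real) \<Rightarrow> bool" where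
  "solves_integral_equation m \<alpha> F u0 u \<longleftrightarrow>
     (AE x in lebesgue. u 0 x = u0 x) \<and>
     (\<forall>t>0. AE x in lebesgue.
        set_integrable lebesgue {0<..<t} (duhamel_integrand m \<alpha> F u t x) \<and>
        u t x = heat_semigroup m t u0 x
          + set_lebesgue_integral lebesgue {0<..<t} (duhamel_integrand m \<alpha> F u t x))"

definition rescale ::
    "real \<Rightarrow> real \<Rightarrow> real \<Rightarrow> real \<Rightarrow> (real \<Rightarrow> 'a::euclidean_space \<Rightarrow> real) \<Rightarrow>
     real \<Rightarrow> 'a \<Rightarrow> real" where
  "rescale m \<alpha> p \<sigma> u t x =
     \<sigma> powr ((2 * m - \<alpha>) / (p - 1)) * u (\<sigma> powr (2 * m) * t) (\<sigma> *\<^sub>R x)"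

definition self_similar ::
    "real \<Rightarrow> real \<Rightarrow> real \<Rightarrow> (real \<Rightarrow> 'a::euclidean_space \<Rightarrow> real) \<Rightarrow> bool" where
  "self_similar m \<alpha> p u \<longleftrightarrow>
     (\<forall>\<sigma>>0. \<forall>t\<ge>0. AE x in lebesgue. u t x = rescale m \<alpha> p \<sigma> u t x)"

text \<open>
  A curve in a Lebesgue space prescribes each time slice only up to a null set, so an arbitrary
  choice of representatives need not be jointly measurable. As a function on space-time it is
  represented by its jointly measurable versions.
\<close>

definition spacetime_version ::
    "(real \<Rightarrow> 'a::euclidean_space \<Rightarrow> real) \<Rightarrow> ('a \<times> real \<Rightarrow> real) \<Rightarrow> bool" where
  "spacetime_version u v \<longleftrightarrow>
     v \<in> borel_measurable lebesgue \<and>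
     (AE t in lebesgue. t > 0 \<longrightarrow> (AE x in lebesgue. v (x, t) = u t x))"

definition vanishes_ae :: "(real \<Rightarrow> 'a::euclidean_space \<Rightarrow> real) \<Rightarrow> bool" where
  "vanishes_ae u \<longleftrightarrow>
     (\<forall>t>0. AE x in lebesgue. u t x = 0) \<and>
     (\<forall>v. spacetime_version u v \<longrightarrow> (AE (x, t) in lebesgue. t > 0 \<longrightarrow> v (x, t) = 0))"

end

theory Submission
  imports Defs
begin

text \<open>
  Self-similarity and norm continuity force the solution to vanish. The exponent \<open>q\<^sub>c\<close> satisfies
  \<open>n / q\<^sub>c = (2 * m - \<alpha>) / (p - 1)\<close>, so the rescaling of space-time functions preserves the
  \<open>q\<^sub>c\<close>-norm of time slices (\<open>Lp_norm_homogeneous_dilation\<close>). This has two consequences.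

  At time \<open>0\<close>, self-similarity says that \<open>\<bar>u 0\<bar> powr q\<^sub>c\<close> is homogeneous of degree \<open>- n\<close>.
  Its integral over a ball about the origin therefore does not depend on the radius. Letting the
  radius tend to \<open>0\<close> and to \<open>\<infinity>\<close> shows that an integrable function of this kind has integral
  \<open>0\<close> (\<open>homogeneous_integrable_eq_0\<close>), so \<open>u 0 = 0\<close>.

  At positive times, the slices \<open>u t\<close> are dilations of one another, so \<open>\<parallel>u t\<parallel>\<close> is constant in
  \<open>t > 0\<close>. Norm continuity at \<open>t = 0\<close> makes it tend to \<open>\<parallel>u 0\<parallel> = 0\<close>, hence \<open>u t = 0\<close> for
  every \<open>t > 0\<close>.

  The passage to functions on space-time is Tonelli's theorem for null sets, transferred from
  Borel to Lebesgue measurable sets (\<open>null_of_null_slices\<close>).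
\<close>

section \<open>Dilations and homogeneous integrable functions\<close>

text \<open>
  The product over the basis in the general affine transformation formula becomes
  \<open>c ^ DIM('a)\<close>.
\<close>

lemma lebesgue_integral_dilation:
  fixes f :: "'a::euclidean_space \<Rightarrow> real"
  assumes f [measurable]: "f \<in> borel_measurable lebesgue" and c: "c > 0"
  shows "(LINT x|lebesgue. f x) = c ^ DIM('a) * (LINT x|lebesgue. f (c *\<^sub>R x))"
proof -
  let ?T = "\<lambda>x::'a. 0 + (\<Sum>j\<in>Basis. (c * (x \<bullet> j)) *\<^sub>R j)"
  have T: "?T = (\<lambda>x. c *\<^sub>R x)"
    unfolding scaleR_scaleR [symmetric] scaleR_sum_right [symmetric] euclidean_representation
    by simp
  have "lebesgue = density (distr lebesgue lebesgue ?T) (\<lambda>_. ennreal (\<Prod>j\<in>(Basis::'a set). \<bar>c\<bar>))"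
    using c by (intro lebesgue_affine_euclidean) auto
  then have leb: "(lebesgue :: 'a measure)
      = density (distr lebesgue lebesgue (\<lambda>x. c *\<^sub>R x)) (\<lambda>_. ennreal (c ^ DIM('a)))"
    unfolding T using c by simp
  have "(LINT x|lebesgue. f x)
      = (LINT x|density (distr lebesgue lebesgue (\<lambda>x. c *\<^sub>R x)) (\<lambda>_. ennreal (c ^ DIM('a))). f x)"
    using leb by simp
  also have "\<dots> = (LINT x|distr lebesgue lebesgue (\<lambda>x. c *\<^sub>R x). c ^ DIM('a) * f x)"
    using c by (subst integral_density) auto
  also have "\<dots> = c ^ DIM('a) * (LINT x|lebesgue. f (c *\<^sub>R x))"
    by (subst integral_distr) auto
  finally show ?thesis .
qed

text \<open>
  The degree \<open>- DIM('a)\<close> makes \<open>h x dx\<close> a dilation invariant measure. All balls about the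
  origin then have the same mass, which is both the limit \<open>0\<close> of the masses of shrinking balls
  and the total mass.
\<close>

lemma homogeneous_integrable_eq_0:
  fixes h :: "'a::euclidean_space \<Rightarrow> real"
  assumes int: "integrable lebesgue h" and nonneg: "\<And>x. h x \<ge> 0"
    and hom: "\<And>c. c > 0 \<Longrightarrow> AE x in lebesgue. h x = c ^ DIM('a) * h (c *\<^sub>R x)"
  shows "AE x in lebesgue. h x = 0"
proof -
  have [measurable]: "h \<in> borel_measurable lebesgue"
    using int by auto
  have ball [measurable]: "ball (0::'a) r \<in> sets lebesgue" for r
    by simp
  have ball_h: "(\<lambda>x. indicator (ball 0 r) x * h x) \<in> borel_measurable lebesgue" for r
    by measurable
  define I where "I r = (LINT x|lebesgue. indicator (ball 0 r) x * h x)" for r :: real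
  have const: "I r = I 1" if r: "r > 0" for r
  proof -
    have "I r = r ^ DIM('a) * (LINT x|lebesgue. indicator (ball 0 r) (r *\<^sub>R x) * h (r *\<^sub>R x))"
      unfolding I_def using r by (subst lebesgue_integral_dilation [of _ r]) auto
    also have "\<dots> = (LINT x|lebesgue. indicator (ball 0 1) x * (r ^ DIM('a) * h (r *\<^sub>R x)))"
      unfolding Bochner_Integration.integral_mult_right_zero [symmetric]
      using r by (intro Bochner_Integration.integral_cong) (auto simp: indicator_def)
    also have "\<dots> = I 1"
      unfolding I_def
    proof (rule integral_cong_AE)
      show "AE x in lebesgue. indicator (ball 0 1) x * (r ^ DIM('a) * h (r *\<^sub>R x))
          = indicator (ball 0 1) x * h x"
        using hom [OF r] by eventually_elim simp
    qed measurable
    finally show ?thesis .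
  qed
  have small: "(\<lambda>k. I (1 / real (Suc k))) \<longlonglongrightarrow> (LINT x|(lebesgue :: 'a measure). 0)"
    unfolding I_def
  proof (rule integral_dominated_convergence [where w = h])
    have "AE x in lebesgue. x \<noteq> (0::'a)"
      by (rule AE_completion) (rule AE_lborel_singleton)
    then show "AE x in lebesgue. (\<lambda>k. indicator (ball 0 (1 / real (Suc k))) x * h x) \<longlonglongrightarrow> 0"
    proof eventually_elim
      case (elim x)
      have "(\<lambda>k. 1 / real (Suc k)) \<longlonglongrightarrow> 0"
        using LIMSEQ_inverse_real_of_nat by (simp add: divide_inverse)
      then have "eventually (\<lambda>k. 1 / real (Suc k) < norm x) sequentially"
        using elim by (intro order_tendstoD) auto
      then show ?case
        by (intro tendsto_eventually) (auto elim!: eventually_mono)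
    qed
  qed (use int nonneg ball_h in \<open>auto split: split_indicator\<close>)
  have large: "(\<lambda>k. I (real (Suc k))) \<longlonglongrightarrow> (LINT x|lebesgue. h x)"
    unfolding I_def
  proof (rule integral_dominated_convergence [where w = h])
    show "AE x in lebesgue. (\<lambda>k. indicator (ball 0 (real (Suc k))) x * h x) \<longlonglongrightarrow> h x"
    proof (rule AE_I2)
      fix x :: 'a
      have "filterlim (\<lambda>k. real (Suc k)) at_top sequentially"
        by (intro filterlim_compose [OF filterlim_real_sequentially filterlim_Suc])
      then have "eventually (\<lambda>k. norm x < real (Suc k)) sequentially"
        by (auto simp: filterlim_at_top_dense)
      then have "eventually (\<lambda>k. indicator (ball 0 (real (Suc k))) x * h x = h x) sequentially"
        by (rule eventually_mono) (simp add: indicator_def)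
      then show "(\<lambda>k. indicator (ball 0 (real (Suc k))) x * h x) \<longlonglongrightarrow> h x"
        by (rule tendsto_eventually)
    qed
  qed (use int nonneg ball_h in \<open>auto split: split_indicator\<close>)
  have "I (1 / real (Suc k)) = I 1" "I (real (Suc k)) = I 1" for k
    by (rule const, simp)+
  then have "I 1 = 0" and "(LINT x|lebesgue. h x) = I 1"
    using small large by (simp_all only: LIMSEQ_const_iff Bochner_Integration.integral_zero)
  then have "(LINT x|lebesgue. h x) = 0"
    by simp
  then show ?thesis
    using int nonneg by (subst (asm) integral_nonneg_eq_0_iff_AE) auto
qed

section \<open>Scaling of Lebesgue norms\<close>

lemma powr_homogeneous:
  fixes c q :: real
  assumes "c > 0" "q > 0"
  shows "\<bar>c powr (real d / q) * y\<bar> powr q = c ^ d * \<bar>y\<bar> powr q"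
  using assms by (simp add: abs_mult powr_mult powr_powr powr_realpow)

lemma Lp_norm_cong_AE:
  assumes "f \<in> borel_measurable lebesgue" "g \<in> borel_measurable lebesgue"
    and "AE x in lebesgue. f x = g x"
  shows "Lp_norm q f = Lp_norm q g"
proof -
  have "(LINT x|lebesgue. \<bar>f x\<bar> powr q) = (LINT x|lebesgue. \<bar>g x\<bar> powr q)"
    using assms by (intro integral_cong_AE) (auto elim: eventually_mono)
  then show ?thesis
    by (simp add: Lp_norm_def)
qed

lemma Lp_norm_eq_0_AE:
  assumes "f \<in> Lp_space q" "Lp_norm q f = 0"
  shows "AE x in lebesgue. f x = 0"
proof -
  have "(LINT x|lebesgue. \<bar>f x\<bar> powr q) = 0"
    using assms by (simp add: Lp_norm_def)
  then show ?thesis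
    using assms by (subst (asm) integral_nonneg_eq_0_iff_AE) (auto simp: Lp_space_def)
qed

text \<open>
  The factor \<open>c powr (DIM('a) / q)\<close> is the one that turns dilation by \<open>c\<close> into an isometry of
  the Lebesgue space with exponent \<open>q\<close>.
\<close>

lemma Lp_norm_homogeneous_dilation:
  fixes f g :: "'a::euclidean_space \<Rightarrow> real"
  assumes [measurable]: "f \<in> borel_measurable lebesgue" "g \<in> borel_measurable lebesgue"
    and "c > 0" "q > 0"
    and eq: "AE x in lebesgue. g x = c powr (real DIM('a) / q) * f (c *\<^sub>R x)"
  shows "Lp_norm q g = Lp_norm q f"
proof -
  have "(LINT x|lebesgue. \<bar>g x\<bar> powr q) = (LINT x|lebesgue. c ^ DIM('a) * \<bar>f (c *\<^sub>R x)\<bar> powr q)"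
  proof (rule integral_cong_AE)
    show "AE x in lebesgue. \<bar>g x\<bar> powr q = c ^ DIM('a) * \<bar>f (c *\<^sub>R x)\<bar> powr q"
      using eq by eventually_elim (simp add: powr_homogeneous assms)
  qed measurable
  also have "\<dots> = (LINT x|lebesgue. \<bar>f x\<bar> powr q)"
    using \<open>c > 0\<close> by (subst lebesgue_integral_dilation [of "\<lambda>x. \<bar>f x\<bar> powr q" c]) auto
  finally show ?thesis
    by (simp add: Lp_norm_def)
qed

lemma Lp_homogeneous_eq_0:
  fixes f :: "'a::euclidean_space \<Rightarrow> real"
  assumes f: "f \<in> Lp_space q" and "q > 0"
    and hom: "\<And>c. c > 0 \<Longrightarrow> AE x in lebesgue. f x = c powr (real DIM('a) / q) * f (c *\<^sub>R x)"
  shows "AE x in lebesgue. f x = 0"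
proof -
  have "AE x in lebesgue. \<bar>f x\<bar> powr q = 0"
  proof (rule homogeneous_integrable_eq_0)
    fix c :: real assume "c > 0"
    with hom [OF this] show "AE x in lebesgue. \<bar>f x\<bar> powr q = c ^ DIM('a) * \<bar>f (c *\<^sub>R x)\<bar> powr q"
      by (auto elim!: eventually_mono simp: powr_homogeneous \<open>q > 0\<close>)
  qed (use f in \<open>auto simp: Lp_space_def\<close>)
  then show ?thesis
    by simp
qed

section \<open>Null sets in space-time\<close>

text \<open>
  The Lebesgue measurable set \<open>A\<close> need not belong to the product \<open>\<sigma>\<close>-algebra, so Tonelli's
  theorem is applied to its Borel part, from which \<open>A\<close> differs by a null set. The slices of the
  Borel part are null because they are contained in the slices of \<open>A\<close>.
\<close>

lemma null_of_null_slices: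
  fixes A :: "('a::euclidean_space \<times> 'b::euclidean_space) set"
  assumes A: "A \<in> sets lebesgue"
    and slices: "AE t in lebesgue. AE x in lebesgue. (x, t) \<notin> A"
  shows "AE z in lebesgue. z \<notin> A"
proof -
  define B where "B = main_part lborel A"
  have B: "B \<in> sets borel" and sub: "B \<subseteq> A"
    using main_part_sets [OF A] main_part_null_part_Un [OF A] by (auto simp: B_def)
  have "{z. z \<notin> B} = - B"
    by auto
  then have meas: "{z \<in> space (lborel \<Otimes>\<^sub>M lborel). (fst z, snd z) \<notin> B} \<in> sets (lborel \<Otimes>\<^sub>M lborel)"
    unfolding lborel_prod using borel_comp [OF B] by simp
  have "AE t in lborel. AE x in lborel. (x, t) \<notin> B"
    using slices sub unfolding AE_completion_iff by (auto elim!: eventually_mono)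
  then have "AE x in lborel. AE t in lborel. (x, t) \<notin> B"
    using lborel_pair.AE_commute [where P = "\<lambda>x t. (x, t) \<notin> B", OF meas] by blast
  then have "AE z in lborel \<Otimes>\<^sub>M lborel. (fst z, snd z) \<notin> B"
    using lborel_pair.AE_pair_iff [where P = "\<lambda>x t. (x, t) \<notin> B", OF meas] by blast
  then have "AE z in lborel. z \<notin> B"
    unfolding lborel_prod prod.collapse .
  with AE_in_main_part [OF A] have "AE z in lborel. z \<notin> A"
    unfolding B_def by eventually_elim blast
  then show ?thesis
    by (rule AE_completion)
qed

lemma vanishes_ae_if_slices:
  fixes u :: "real \<Rightarrow> 'a::euclidean_space \<Rightarrow> real"
  assumes slices: "\<And>t. t > 0 \<Longrightarrow> AE x in lebesgue. u t x = 0"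
  shows "vanishes_ae u"
  unfolding vanishes_ae_def
proof (intro conjI allI impI)
  fix v assume v: "spacetime_version u v"
  define A where "A = {z. snd z > 0} \<inter> (v -` (- {0}) \<inter> space lebesgue)"
  have "open {z :: 'a \<times> real. snd z > 0}"
    by (intro open_Collect_less continuous_intros)
  then have "A \<in> sets lebesgue"
    unfolding A_def using v
    by (intro sets.Int measurable_sets [of v _ borel]) (auto simp: spacetime_version_def)
  moreover have "AE t in lebesgue. AE x in lebesgue. (x, t) \<notin> A"
    using v [unfolded spacetime_version_def, THEN conjunct2]
  proof eventually_elim
    case (elim t)
    show ?case
    proof (cases "t > 0")
      case True
      with elim have "AE x in lebesgue. v (x, t) = u t x"
        by simp
      with slices [OF True] show ?thesis
        by eventually_elim (simp add: A_def)
    qed (simp add: A_def)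
  qed
  ultimately have "AE z in lebesgue. z \<notin> A"
    by (rule null_of_null_slices)
  then show "AE (x, t) in lebesgue. t > 0 \<longrightarrow> v (x, t) = 0"
    by eventually_elim (auto simp: A_def)
qed (rule slices)

section \<open>Self-similar curves in a Lebesgue space\<close>

text \<open>
  The relation between the exponents says that rescaling preserves the norm with exponent \<open>q\<close>,
  so the positive times carry one and the same norm, which continuity at time \<open>0\<close> determines.
\<close>

lemma self_similar_Cb_Lp_vanishes:
  fixes u :: "real \<Rightarrow> 'a::euclidean_space \<Rightarrow> real"
  assumes u: "u \<in> Cb_Lp q" and "self_similar m \<alpha> p u" and "q > 0" "m > 0"
    and exponent: "(2 * m - \<alpha>) / (p - 1) = real DIM('a) / q"
  shows "vanishes_ae u"
proof (rule vanishes_ae_if_slices)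
  have Lp: "u t \<in> Lp_space q" if "t \<ge> 0" for t
    using u that by (auto simp: Cb_Lp_def)
  then have meas: "u t \<in> borel_measurable lebesgue" if "t \<ge> 0" for t
    using that by (auto simp: Lp_space_def)
  have scaling: "AE x in lebesgue.
      u t x = c powr (real DIM('a) / q) * u (c powr (2 * m) * t) (c *\<^sub>R x)"
    if "c > 0" "t \<ge> 0" for c t
    using \<open>self_similar m \<alpha> p u\<close> that
    unfolding self_similar_def rescale_def exponent by blast
  have initial: "AE x in lebesgue. u 0 x = 0"
    using Lp_homogeneous_eq_0 [OF Lp [of 0] \<open>q > 0\<close>] scaling [of _ 0] by simp
  have const: "Lp_norm q (u t) = Lp_norm q (u 1)" if t: "t > 0" for t
  proof (rule Lp_norm_homogeneous_dilation)
    \<comment> \<open>The dilation that moves time \<open>t\<close> to time \<open>1\<close>.\<close>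
    let ?c = "t powr (- 1 / (2 * m))"
    show "?c > 0"
      using t by simp
    have "?c powr (2 * m) = t powr (- 1)"
      using \<open>m > 0\<close> unfolding powr_powr by simp
    then have "?c powr (2 * m) * t = 1"
      using t by (simp add: powr_minus)
    then show "AE x in lebesgue. u t x = ?c powr (real DIM('a) / q) * u 1 (?c *\<^sub>R x)"
      using scaling [of ?c t] t by simp
  qed (use t meas \<open>q > 0\<close> in auto)
  have "((\<lambda>t. Lp_norm q (\<lambda>x. u t x - u 0 x)) \<longlongrightarrow> 0) (at 0 within {0..})"
    using u by (auto simp: Cb_Lp_def)
  then have "((\<lambda>t. Lp_norm q (\<lambda>x. u t x - u 0 x)) \<longlongrightarrow> 0) (at_right 0)"
    by (rule tendsto_within_subset) auto
  moreover have "eventually (\<lambda>t. Lp_norm q (\<lambda>x. u t x - u 0 x) = Lp_norm q (u 1)) (at_right 0)"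
    unfolding eventually_at_filter
  proof (intro always_eventually allI impI)
    fix t :: real assume "t \<in> {0<..}"
    then have "t > 0" by simp
    then have "Lp_norm q (\<lambda>x. u t x - u 0 x) = Lp_norm q (u t)"
      using initial meas [of t] meas [of 0]
      by (intro Lp_norm_cong_AE) (auto elim!: eventually_mono)
    with const [OF \<open>t > 0\<close>] show "Lp_norm q (\<lambda>x. u t x - u 0 x) = Lp_norm q (u 1)"
      by simp
  qed
  ultimately have "((\<lambda>t. Lp_norm q (u 1)) \<longlongrightarrow> 0) (at_right (0::real))"
    by (rule Lim_transform_eventually)
  then have "Lp_norm q (u 1) = 0"
    by (simp add: tendsto_const_iff)
  then show "AE x in lebesgue. u t x = 0" if "t > 0" for t
    using const [OF that] Lp_norm_eq_0_AE [OF Lp] that by simp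
qed

theorem corollary5p3:
  fixes m \<alpha> p n q\<^sub>c :: real and F :: "real \<Rightarrow> real"
  assumes "n = real CARD('n::finite)"
    and "m \<in> {0<..<1} \<union> \<nat>"
    and "0 < \<alpha>" and "\<alpha> < 2 * m" and "2 * m < n"
    and "(n - \<alpha>) / (n - 2 * m) < p"
    and "q\<^sub>c = n * (p - 1) / (2 * m - \<alpha>)"
    and "F 0 = 0"
    and "\<exists>C>0. \<forall>a b. \<bar>F a - F b\<bar> \<le> C * \<bar>a - b\<bar> * (\<bar>a\<bar> powr (p - 1) + \<bar>b\<bar> powr (p - 1))"
    and "\<forall>s>0. \<forall>a. F (s * a) = s powr p * F a"
  shows "\<exists>\<epsilon>>0. \<forall>(u :: real \<Rightarrow> real ^ 'n \<Rightarrow> real) u0.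
           u \<in> Cb_Lp q\<^sub>c \<longrightarrow> solves_integral_equation m \<alpha> F u0 u \<longrightarrow>
           Lp_norm q\<^sub>c u0 < \<epsilon> \<longrightarrow> self_similar m \<alpha> p u \<longrightarrow> vanishes_ae u"
proof -
  have "1 < (n - \<alpha>) / (n - 2 * m)"
    using \<open>\<alpha> < 2 * m\<close> \<open>2 * m < n\<close> by (simp add: field_simps)
  then have "p > 1"
    using \<open>(n - \<alpha>) / (n - 2 * m) < p\<close> by simp
  moreover have "m > 0"
    using assms by simp
  ultimately have q: "q\<^sub>c > 0"
    unfolding \<open>q\<^sub>c = n * (p - 1) / (2 * m - \<alpha>)\<close>
    using \<open>\<alpha> < 2 * m\<close> \<open>2 * m < n\<close> by simp
  have "(2 * m - \<alpha>) / (p - 1) = n / q\<^sub>c"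
    unfolding \<open>q\<^sub>c = n * (p - 1) / (2 * m - \<alpha>)\<close>
    using \<open>m > 0\<close> \<open>2 * m < n\<close> by simp
  then have exponent: "(2 * m - \<alpha>) / (p - 1) = real DIM(real ^ 'n) / q\<^sub>c"
    using \<open>n = real CARD('n)\<close> by simp
  have "vanishes_ae u" if "u \<in> Cb_Lp q\<^sub>c" "self_similar m \<alpha> p u" for u :: "real \<Rightarrow> real ^ 'n \<Rightarrow> real"
    using that q \<open>m > 0\<close> exponent by (rule self_similar_Cb_Lp_vanishes)
  then show ?thesis
    by (intro exI [of _ 1]) simp
qed

end
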